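(* Let $d$ be a positive integer. A $d\times d$ matrix with all diagonal entries equal to $1$ is a tail-dependence matrix if and only if it is a Bernoulli-compatible matrix multiplied by a (nonnegative) constant. Equivalently, $\mathcal{T}_d=\mathcal{B}^I_d$, where $\mathcal{T}_d$ is the set of all $d\times d$ tail-dependence matrices and $\mathcal{B}^I_d=\{aB:\ a\ge 0,\ B\in\mathcal{B}_d,\ \text{all diagonal entries of } aB \text{ equal } 1\}$, with $\mathcal{B}_d$ the set of all $d\times d$ Bernoulli-compatible matrices.
   Context: All random variables live on an atomless probability space. Vectors are column vectors. A $d$-Bernoulli vector is a random vector with values in $\{0,1\}^d$ (any dependence structure, any marginal probabilities in $[0,1]$). A $d\times d$ matrix $B$ is Bernoulli-compatible if $B=\mathbb{E}[\mathbf{X}\mathbf{X}^\top]$ for some $d$-Bernoulli vector $\mathbf{X}$. The (lower) tail-dependence coefficient of two random variables $X_1\sim F_1$, $X_2\sim F_2$ with continuous distribution functions is $\lambda=\lim_{u\downarrow 0}\frac{1}{u}\mathbb{P}(F_1(X_1)\le u,\ F_2(X_2)\le u)$, given that the limit exists. The tail-dependence matrix of a random vector $\mathbf{X}=(X_1,\ldots,X_d)$ with continuous marginal distributions (for which all pairwise limits exist) is $\Lambda=(\lambda_{ij})_{d\times d}$, where $\lambda_{ij}$ is the tail-dependence coefficient of $X_i$ and $X_j$. A matrix is called a tail-dependence matrix if it is the tail-dependence matrix of some such random vector. *)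

theory Defs
  imports "HOL-Probability.Probability"
begin

definition atomless :: "'a measure \<Rightarrow> bool" where
  "atomless M \<longleftrightarrow>
     (\<forall>A\<in>sets M. 0 < emeasure M A \<longrightarrow>
        (\<exists>B\<in>sets M. B \<subseteq> A \<and> 0 < emeasure M B \<and> emeasure M B < emeasure M A))"

definition bernoulli_vector :: "'a measure \<Rightarrow> ('a \<Rightarrow> real ^ 'd) \<Rightarrow> bool" where
  "bernoulli_vector M X \<longleftrightarrow>
     X \<in> borel_measurable M \<and> (\<forall>\<omega>\<in>space M. \<forall>i. X \<omega> $ i \<in> {0, 1})"

text \<open>The matrix of the entrywise expectations below is the expectation of the matrix product of
  the column vector \<open>X\<close> with its transpose.\<close>

definition bernoulli_compatible :: "'a measure \<Rightarrow> (real ^ 'd ^ 'd) set" where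
  "bernoulli_compatible M =
     {B. \<exists>X. bernoulli_vector M X \<and>
        B = (\<chi> i j. integral\<^sup>L M (\<lambda>\<omega>. X \<omega> $ i * X \<omega> $ j))}"

definition scaled_bernoulli_compatible :: "'a measure \<Rightarrow> (real ^ 'd ^ 'd) set" where
  "scaled_bernoulli_compatible M =
     {a *\<^sub>R B | a B. 0 \<le> a \<and> B \<in> bernoulli_compatible M \<and> (\<forall>i. (a *\<^sub>R B) $ i $ i = 1)}"

definition distribution_function :: "'a measure \<Rightarrow> ('a \<Rightarrow> real) \<Rightarrow> real \<Rightarrow> real" where
  "distribution_function M X = cdf (distr M borel X)"

text \<open>The limit, when it exists, is unique, so this relation determines \<open>l\<close>.\<close>

definition has_tail_dependence_coefficient ::
    "'a measure \<Rightarrow> ('a \<Rightarrow> real) \<Rightarrow> ('a \<Rightarrow> real) \<Rightarrow> real \<Rightarrow> bool" where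
  "has_tail_dependence_coefficient M X Y l \<longleftrightarrow>
     ((\<lambda>u. 1 / u * measure M {\<omega>\<in>space M. distribution_function M X (X \<omega>) \<le> u \<and>
                                        distribution_function M Y (Y \<omega>) \<le> u}) \<longlongrightarrow> l) (at_right 0)"

definition tail_dependence_matrix_of ::
    "'a measure \<Rightarrow> ('a \<Rightarrow> real ^ 'd) \<Rightarrow> real ^ 'd ^ 'd \<Rightarrow> bool" where
  "tail_dependence_matrix_of M X \<Lambda> \<longleftrightarrow>
     X \<in> borel_measurable M \<and>
     (\<forall>i. continuous_on UNIV (distribution_function M (\<lambda>\<omega>. X \<omega> $ i))) \<and>
     (\<forall>i j. has_tail_dependence_coefficient M (\<lambda>\<omega>. X \<omega> $ i) (\<lambda>\<omega>. X \<omega> $ j) (\<Lambda> $ i $ j))"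

definition tail_dependence_matrices :: "'a measure \<Rightarrow> (real ^ 'd ^ 'd) set" where
  "tail_dependence_matrices M = {\<Lambda>. \<exists>X. tail_dependence_matrix_of M X \<Lambda>}"

end

theory Submission
  imports Defs
begin

text \<open>Bernoulli-compatible matrices form the polytope spanned by the matrices \<open>1\<^sub>A 1\<^sub>A\<^sup>T\<close>, where \<open>A\<close>
  ranges over the sets of indices. Given a vector with tail-dependence matrix \<open>\<Lambda>\<close>, the matrices of the
  probabilities \<open>P(F\<^sub>i(X\<^sub>i) \<le> u, F\<^sub>j(X\<^sub>j) \<le> u)\<close>, divided by \<open>d u\<close>, lie in this polytope, because the index
  set \<open>{i. F\<^sub>i(X\<^sub>i) \<le> u}\<close> is nonempty with probability at most \<open>d u\<close>; as the polytope is closed, it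
  contains the limit \<open>\<Lambda> / d\<close>. Conversely, if \<open>a B\<close> has unit diagonal and \<open>B\<close> comes from a random index set
  \<open>S\<close>, then every index lies in \<open>S\<close> with the same probability \<open>p = 1 / a\<close>. With \<open>V\<close> uniform and
  independent of \<open>S\<close>, the variables \<open>p V\<close> for \<open>i \<in> S\<close> and \<open>p + (1 - p) V\<close> for \<open>i \<notin> S\<close> are uniform and
  have tail-dependence matrix \<open>a B\<close>.\<close>

subsection \<open>Uniform variables on atomless spaces\<close>

text \<open>At the first index \<open>n\<close> where the digits differ, the two series differ by a
  term of size \<open>(1/3) ^ n\<close>, while all later terms together contribute at most half of
  that. In base 2 the tail could cancel the term, so base 3 is essential to this estimate.\<close>

lemma ternary_series_inj:
  fixes a b :: "nat \<Rightarrow> bool"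
  assumes eq: "(\<Sum>n. of_bool (a n) * (1/3) ^ n :: real) = (\<Sum>n. of_bool (b n) * (1/3) ^ n)"
  shows "a = b"
proof (rule ccontr)
  assume "a \<noteq> b"
  then have "\<exists>n. a n \<noteq> b n" by auto
  then obtain n where n: "a n \<noteq> b n" and least: "\<And>m. m < n \<Longrightarrow> a m = b m"
    using exists_least_iff[of "\<lambda>n. a n \<noteq> b n"] by metis
  define c :: "nat \<Rightarrow> real" where "c k = (of_bool (a k) - of_bool (b k)) * (1/3) ^ k" for k
  have geo: "summable (\<lambda>k. (1/3 :: real) ^ k)" by simp
  have sa: "summable (\<lambda>k. of_bool (d k) * (1/3 :: real) ^ k)" for d :: "nat \<Rightarrow> bool"
    by (rule summable_comparison_test'[OF geo, of 0]) auto
  have c_split: "c k = of_bool (a k) * (1/3) ^ k - of_bool (b k) * (1/3) ^ k" for k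
    by (simp add: c_def algebra_simps)
  have sc: "summable c" unfolding c_split by (intro summable_diff sa)
  have "(\<Sum>k. c k) = 0"
    unfolding c_split using eq by (subst suminf_diff[symmetric]) (auto intro: sa)
  moreover have "(\<Sum>k. c k) = (\<Sum>k. c (k + Suc n)) + (\<Sum>k<Suc n. c k)"
    using suminf_split_initial_segment[OF sc] .
  moreover have "(\<Sum>k<Suc n. c k) = c n"
    using least by (auto simp: c_def intro!: sum.neutral)
  ultimately have "\<bar>c n\<bar> = \<bar>\<Sum>k. c (k + Suc n)\<bar>" by simp
  also have "\<dots> \<le> (\<Sum>k. (1/3) ^ Suc n * (1/3) ^ k)"
  proof -
    have bd: "norm (c (k + Suc n)) \<le> (1/3) ^ Suc n * (1/3) ^ k" for k
      by (auto simp: c_def power_add)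
    have "summable (\<lambda>k. (1/3 :: real) ^ Suc n * (1/3) ^ k)"
      by (rule summable_mult[OF geo])
    from norm_suminf_le[OF bd this] show ?thesis by simp
  qed
  also have "\<dots> = (1/3) ^ n / 2"
    by (subst suminf_mult[OF geo]) (simp add: suminf_geometric)
  also have "\<dots> < (1/3) ^ n" by simp
  also have "\<dots> = \<bar>c n\<bar>" using n by (auto simp: c_def)
  finally show False by simp
qed

text \<open>The sequence \<open>D\<close> minimises the probability that two independent points lie in the same cell; a cell
  of positive measure could be split further, contradicting minimality.\<close>

lemma (in prob_space) atomless_imp_null_cells:
  assumes "atomless M"
  obtains D :: "nat \<Rightarrow> 'a set" where "range D \<subseteq> events"
    and "\<And>\<omega>. \<omega> \<in> space M \<Longrightarrow> prob {\<omega>'\<in>space M. \<forall>n. \<omega>' \<in> D n \<longleftrightarrow> \<omega> \<in> D n} = 0"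
proof -
  interpret P: pair_prob_space M M ..
  \<comment> \<open>The pairs lying in the same cell of the partition generated by \<open>D\<close>;
    the product measure of this set is the quantity to be minimised.\<close>
  define R :: "(nat \<Rightarrow> 'a set) \<Rightarrow> ('a \<times> 'a) set"
    where "R D = {p\<in>space (M \<Otimes>\<^sub>M M). \<forall>n. fst p \<in> D n \<longleftrightarrow> snd p \<in> D n}" for D
  have R_meas [measurable]: "R D \<in> sets (M \<Otimes>\<^sub>M M)" if "range D \<subseteq> events" for D
  proof -
    have [measurable]: "D n \<in> events" for n using that by auto
    show ?thesis unfolding R_def by measurable
  qed
  define \<Phi> where "\<Phi> = (\<lambda>D. measure (M \<Otimes>\<^sub>M M) (R D)) ` {D. range D \<subseteq> events}"
  have bdd: "bdd_below \<Phi>" unfolding \<Phi>_def by (rule bdd_belowI2[where m = 0]) auto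
  have ne: "\<Phi> \<noteq> {}" unfolding \<Phi>_def by (auto intro!: exI[of _ "\<lambda>_. {}"])
  have "\<exists>D. range D \<subseteq> events \<and> measure (M \<Otimes>\<^sub>M M) (R D) < Inf \<Phi> + 1 / real (Suc k)" for k
    using cInf_lessD[OF ne, of "Inf \<Phi> + 1 / real (Suc k)"] unfolding \<Phi>_def by auto
  then obtain E where E: "\<And>k. range (E k) \<subseteq> events"
    and E_less: "\<And>k. measure (M \<Otimes>\<^sub>M M) (R (E k)) < Inf \<Phi> + 1 / real (Suc k)"
    by metis
  \<comment> \<open>Merging all the near-optimal sequences \<open>E k\<close> into one yields a
    partition at least as fine as each of theirs, so the infimum of \<open>\<Phi>\<close> is
    attained at \<open>D\<close>.\<close>
  define D where "D n = (case prod_decode n of (k, m) \<Rightarrow> E k m)" for n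
  have D: "range D \<subseteq> events" using E by (auto simp: D_def split: prod.split)
  have "measure (M \<Otimes>\<^sub>M M) (R D) < Inf \<Phi> + 1 / real (Suc k)" for k
  proof -
    have "D (prod_encode (k, m)) = E k m" for m by (simp add: D_def)
    then have "R D \<subseteq> R (E k)" unfolding R_def by auto metis+
    then have "measure (M \<Otimes>\<^sub>M M) (R D) \<le> measure (M \<Otimes>\<^sub>M M) (R (E k))"
      by (intro P.finite_measure_mono R_meas E)
    with E_less[of k] show ?thesis by simp
  qed
  note less = this
  have min: "measure (M \<Otimes>\<^sub>M M) (R D) \<le> Inf \<Phi>"
  proof (rule field_le_epsilon)
    fix e :: real assume "0 < e"
    from \<open>0 < e\<close> obtain k where "1 / real (Suc k) < e" by (rule nat_approx_posE)
    with less[of k] show "measure (M \<Otimes>\<^sub>M M) (R D) \<le> Inf \<Phi> + e" by linarith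
  qed
  have "prob {\<omega>'\<in>space M. \<forall>n. \<omega>' \<in> D n \<longleftrightarrow> \<omega> \<in> D n} = 0" if "\<omega> \<in> space M" for \<omega>
  proof (rule ccontr)
    define C where "C = {\<omega>'\<in>space M. \<forall>n. \<omega>' \<in> D n \<longleftrightarrow> \<omega> \<in> D n}"
    assume "prob {\<omega>'\<in>space M. \<forall>n. \<omega>' \<in> D n \<longleftrightarrow> \<omega> \<in> D n} \<noteq> 0"
    then have "0 < emeasure M C"
      by (simp add: C_def emeasure_eq_measure less_le)
    moreover have [measurable]: "C \<in> events"
    proof -
      have [measurable]: "D n \<in> events" for n using D by auto
      show ?thesis unfolding C_def by measurable
    qed
    ultimately obtain B where B [measurable]: "B \<in> events" and "B \<subseteq> C"
      and "0 < emeasure M B" "emeasure M B < emeasure M C"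
      using assms unfolding atomless_def by blast
    then have pos: "0 < prob B" "0 < prob (C - B)"
      by (auto simp: emeasure_eq_measure finite_measure_Diff ennreal_less_iff)
    \<comment> \<open>Prepending \<open>B\<close> separates \<open>B\<close> from
      \<open>C - B\<close>: the rectangle \<open>B \<times> (C - B)\<close> lies in
      \<open>R D\<close> but is disjoint from \<open>R D'\<close>. Since it has positive measure,
      \<open>D'\<close> would fall below the infimum.\<close>
    define D' where "D' n = (case n of 0 \<Rightarrow> B | Suc m \<Rightarrow> D m)" for n
    have D': "range D' \<subseteq> events" using D B by (auto simp: D'_def split: nat.split)
    have "D' 0 = B" "D' (Suc m) = D m" for m by (auto simp: D'_def)
    then have R': "R D' = {p\<in>R D. fst p \<in> B \<longleftrightarrow> snd p \<in> B}"
      unfolding R_def by (auto simp: D'_def split: nat.splits)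
    have "measure (M \<Otimes>\<^sub>M M) (B \<times> (C - B)) = prob B * prob (C - B)"
      by (simp add: measure_def emeasure_pair_measure_Times enn2real_mult)
    moreover have "measure (M \<Otimes>\<^sub>M M) (R D') + measure (M \<Otimes>\<^sub>M M) (B \<times> (C - B))
        = measure (M \<Otimes>\<^sub>M M) (R D' \<union> B \<times> (C - B))"
      using D' by (intro P.finite_measure_Union[symmetric] R_meas) (auto simp: R')
    moreover have "\<dots> \<le> measure (M \<Otimes>\<^sub>M M) (R D)"
    proof (intro P.finite_measure_mono R_meas D)
      have "B \<times> (C - B) \<subseteq> R D"
        using \<open>B \<subseteq> C\<close> unfolding R_def C_def by (auto simp: space_pair_measure)
      then show "R D' \<union> B \<times> (C - B) \<subseteq> R D" by (auto simp: R')
    qed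
    moreover have "Inf \<Phi> \<le> measure (M \<Otimes>\<^sub>M M) (R D')"
      using D' by (intro cInf_lower bdd) (auto simp: \<Phi>_def)
    ultimately have "prob B * prob (C - B) \<le> 0" using min by simp
    with pos show False by (simp add: mult_le_0_iff)
  qed
  with D show ?thesis by (rule that)
qed

text \<open>Encoding the memberships in the sets \<open>D n\<close> as ternary digits gives a
  function whose nonempty level sets are exactly the cells of the partition, and these are
  null.\<close>

lemma (in prob_space) atomless_imp_continuous_random_variable:
  assumes "atomless M"
  obtains f :: "'a \<Rightarrow> real" where "random_variable borel f"
    and "\<And>x. prob {\<omega>\<in>space M. f \<omega> = x} = 0"
proof -
  obtain D :: "nat \<Rightarrow> 'a set"
    where D: "range D \<subseteq> events"
      and null: "\<And>\<omega>. \<omega> \<in> space M \<Longrightarrow> prob {\<omega>'\<in>space M. \<forall>n. \<omega>' \<in> D n \<longleftrightarrow> \<omega> \<in> D n} = 0"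
    using atomless_imp_null_cells[OF assms] by blast
  have [measurable]: "D n \<in> events" for n using D by auto
  define f :: "'a \<Rightarrow> real" where "f \<omega> = (\<Sum>n. of_bool (\<omega> \<in> D n) * (1/3) ^ n)" for \<omega>
  have "prob {\<omega>\<in>space M. f \<omega> = x} = 0" for x
  proof (cases "\<exists>\<omega>\<in>space M. f \<omega> = x")
    case True
    then obtain \<omega> where \<omega>: "\<omega> \<in> space M" "f \<omega> = x" by blast
    have "{\<omega>'\<in>space M. f \<omega>' = x} \<subseteq> {\<omega>'\<in>space M. \<forall>n. \<omega>' \<in> D n \<longleftrightarrow> \<omega> \<in> D n}"
      using ternary_series_inj[of "\<lambda>n. _ \<in> D n" "\<lambda>n. \<omega> \<in> D n"] \<omega>(2)
      unfolding f_def by (auto dest: fun_cong)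
    then have "prob {\<omega>'\<in>space M. f \<omega>' = x} \<le> prob {\<omega>'\<in>space M. \<forall>n. \<omega>' \<in> D n \<longleftrightarrow> \<omega> \<in> D n}"
      by (rule finite_measure_mono) measurable
    then show ?thesis using null[OF \<omega>(1)] by (simp add: order_antisym)
  next
    case False
    then have "{\<omega>\<in>space M. f \<omega> = x} = {}" by auto
    then show ?thesis by (simp only: measure_empty)
  qed
  moreover have "random_variable borel f" unfolding f_def of_bool_def by measurable
  ultimately show ?thesis using that by blast
qed

section \<open>Continuous distribution functions\<close>

lemma (in prob_space) continuous_distribution_function:
  assumes [measurable]: "random_variable borel X"
    and null: "\<And>x. prob {\<omega>\<in>space M. X \<omega> = x} = 0"
  shows "continuous_on UNIV (distribution_function M X)"
proof -
  interpret D: real_distribution "distr M borel X" by simp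
  have "measure (distr M borel X) {x} = 0" for x
    using null[of x] by (simp add: measure_distr vimage_def Int_def conj_commute)
  then show ?thesis
    by (simp add: distribution_function_def continuous_on_eq_continuous_at D.isCont_cdf)
qed

lemma (in prob_space) distribution_function_eq:
  assumes [measurable]: "random_variable borel X"
  shows "distribution_function M X x = prob {\<omega>\<in>space M. X \<omega> \<le> x}"
  by (simp add: distribution_function_def cdf_def measure_distr vimage_def Int_def conj_commute)

text \<open>The distribution function may be flat, so it need not be invertible. If it takes the
  value \<open>u\<close> at \<open>x\<close>, then \<open>X \<omega> \<le> x\<close> forces the
  event, giving the lower bound. If it takes a value \<open>v > u\<close> at \<open>y\<close>, then
  the event forces \<open>X \<omega> \<le> y\<close>, giving the upper bound \<open>v\<close>, and
  \<open>v\<close> decreases to \<open>u\<close>.\<close>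

lemma (in prob_space) probability_integral_transform:
  assumes [measurable]: "random_variable borel X"
    and cont: "continuous_on UNIV (distribution_function M X)"
    and u: "0 < u" "u < 1"
  shows "prob {\<omega>\<in>space M. distribution_function M X (X \<omega>) \<le> u} = u"
proof -
  interpret D: real_distribution "distr M borel X" by simp
  let ?F = "distribution_function M X"
  have mono: "mono ?F"
    by (simp add: mono_def distribution_function_def D.cdf_nondecreasing)
  have [measurable]: "?F \<in> borel_measurable borel"
    by (rule borel_measurable_continuous_onI[OF cont])
  have range: "\<exists>x. ?F x = v" if v: "0 < v" "v < 1" for v
  proof -
    have "eventually (\<lambda>x. ?F x < v) at_bot" "eventually (\<lambda>x. v < ?F x) at_top"
      using order_tendstoD(2)[OF D.cdf_lim_at_bot] order_tendstoD(1)[OF D.cdf_lim_at_top_prob] v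
      by (auto simp: distribution_function_def)
    then obtain a b where ab: "?F a < v" "v < ?F b"
      by (metis eventually_at_bot_linorder eventually_at_top_linorder order_refl)
    then have "a \<le> b" using monoD[OF mono] by (meson linear not_less order.strict_trans order_trans)
    then show ?thesis
      using IVT'[of ?F a v b] ab continuous_on_subset[OF cont] by auto
  qed
  have "u \<le> prob {\<omega>\<in>space M. ?F (X \<omega>) \<le> u}"
  proof -
    obtain x where x: "?F x = u" using range u by blast
    have "u = prob {\<omega>\<in>space M. X \<omega> \<le> x}" using x by (simp add: distribution_function_eq)
    also have "\<dots> \<le> prob {\<omega>\<in>space M. ?F (X \<omega>) \<le> u}"
      using x monoD[OF mono] by (intro finite_measure_mono) auto
    finally show ?thesis .
  qed
  moreover have "prob {\<omega>\<in>space M. ?F (X \<omega>) \<le> u} \<le> v" if v: "u < v" "v < 1" for v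
  proof -
    obtain y where y: "?F y = v" using range u v by (metis order.strict_trans)
    have "prob {\<omega>\<in>space M. ?F (X \<omega>) \<le> u} \<le> prob {\<omega>\<in>space M. X \<omega> \<le> y}"
    proof (intro finite_measure_mono subsetI)
      fix \<omega> assume "\<omega> \<in> {\<omega>\<in>space M. ?F (X \<omega>) \<le> u}"
      then show "\<omega> \<in> {\<omega>\<in>space M. X \<omega> \<le> y}"
        using monoD[OF mono, of y "X \<omega>"] y v by force
    qed measurable
    also have "\<dots> = v" using y by (simp add: distribution_function_eq)
    finally show ?thesis .
  qed
  then have "prob {\<omega>\<in>space M. ?F (X \<omega>) \<le> u} \<le> u"
    using dense_ge_bounded[OF u(2)] by blast
  ultimately show ?thesis by simp
qed

section \<open>A uniform variable independent of a given finite-valued one\<close>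

lemma (in prob_space) prob_finite_range:
  fixes Z :: "'a \<Rightarrow> 'b::finite"
  assumes [measurable]: "Z \<in> M \<rightarrow>\<^sub>M count_space UNIV" "Measurable.pred M P"
  shows "prob {\<omega>\<in>space M. Z \<omega> \<in> Q \<and> P \<omega>} = (\<Sum>z\<in>Q. prob {\<omega>\<in>space M. Z \<omega> = z \<and> P \<omega>})"
proof -
  have "{\<omega>\<in>space M. Z \<omega> \<in> Q \<and> P \<omega>} = (\<Union>z\<in>Q. {\<omega>\<in>space M. Z \<omega> = z \<and> P \<omega>})" by auto
  also have "prob \<dots> = (\<Sum>z\<in>Q. prob {\<omega>\<in>space M. Z \<omega> = z \<and> P \<omega>})"
    by (rule finite_measure_finite_Union) (auto simp: disjoint_family_on_def)
  finally show ?thesis .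
qed

text \<open>On each event \<open>Z = z\<close> of positive probability, a variable without point
  masses is composed with its own conditional distribution function. The result \<open>V\<close> is
  uniform under every such conditional law, hence uniform and independent of \<open>Z\<close>, which
  is what the product formula expresses.\<close>

lemma (in prob_space) atomless_imp_independent_uniform:
  fixes Z :: "'a \<Rightarrow> 'b::finite"
  assumes "atomless M" and Z [measurable]: "Z \<in> M \<rightarrow>\<^sub>M count_space UNIV"
  obtains V :: "'a \<Rightarrow> real" where "random_variable borel V" "\<And>\<omega>. 0 \<le> V \<omega>" "\<And>\<omega>. V \<omega> \<le> 1"
    "\<And>Q v. 0 \<le> v \<Longrightarrow> v \<le> 1 \<Longrightarrow>
      prob {\<omega>\<in>space M. Z \<omega> \<in> Q \<and> V \<omega> \<le> v} = v * prob {\<omega>\<in>space M. Z \<omega> \<in> Q}"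
proof -
  obtain f :: "'a \<Rightarrow> real" where f [measurable]: "random_variable borel f"
    and null: "\<And>x. prob {\<omega>\<in>space M. f \<omega> = x} = 0"
    using atomless_imp_continuous_random_variable[OF assms(1)] by blast
  define E where "E z = {\<omega>\<in>space M. Z \<omega> = z}" for z
  have E [measurable]: "E z \<in> events" for z unfolding E_def by measurable
  define N where "N z = uniform_measure M (E z)" for z
  \<comment> \<open>\<open>uniform_measure\<close> is not a probability measure on a null set.\<close>
  define G where "G z = (if prob (E z) = 0 then (\<lambda>_. 0) else distribution_function (N z) f)" for z
  define V where "V \<omega> = G (Z \<omega>) (f \<omega>)" for \<omega>
  have N: "prob_space (N z)" "f \<in> borel_measurable (N z)"
      "continuous_on UNIV (distribution_function (N z) f)"
      "\<And>A. A \<in> events \<Longrightarrow> measure (N z) A = prob (E z \<inter> A) / prob (E z)"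
    if "prob (E z) \<noteq> 0" for z
  proof -
    from that have E0: "emeasure M (E z) \<noteq> 0" "emeasure M (E z) \<noteq> \<infinity>"
      by (simp_all add: emeasure_eq_measure)
    show prob: "prob_space (N z)" unfolding N_def by (rule prob_space_uniform_measure[OF E0])
    show meas: "f \<in> borel_measurable (N z)" by (simp add: N_def)
    show N_eq: "measure (N z) A = prob (E z \<inter> A) / prob (E z)" if "A \<in> events" for A
      unfolding N_def using E0 that by (rule measure_uniform_measure)
    \<comment> \<open>Conditioning on an event of positive probability keeps null sets null, so
      \<open>f\<close> has no point masses under \<open>N z\<close> either.\<close>
    have "measure (N z) {\<omega>\<in>space (N z). f \<omega> = x} = 0" for x
    proof -
      have "prob (E z \<inter> {\<omega>\<in>space M. f \<omega> = x}) \<le> prob {\<omega>\<in>space M. f \<omega> = x}"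
        by (rule finite_measure_mono) auto
      then have "prob (E z \<inter> {\<omega>\<in>space M. f \<omega> = x}) = 0"
        using null[of x] by (simp add: order_antisym)
      moreover have "{\<omega>\<in>space (N z). f \<omega> = x} = {\<omega>\<in>space M. f \<omega> = x}" by (simp add: N_def)
      ultimately show ?thesis by (simp add: N_eq)
    qed
    then show "continuous_on UNIV (distribution_function (N z) f)"
      by (rule prob_space.continuous_distribution_function[OF prob meas])
  qed
  have G_meas [measurable]: "G z \<in> borel_measurable borel" for z
    using N(3)[of z] unfolding G_def by (auto intro: borel_measurable_continuous_onI)
  have V_meas [measurable]: "random_variable borel V"
    unfolding V_def by (rule measurable_compose_countable[OF _ Z]) measurable
  have V01: "0 \<le> V \<omega>" "V \<omega> \<le> 1" for \<omega>
  proof -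
    have "0 \<le> G z x \<and> G z x \<le> 1" for z x
    proof (cases "prob (E z) = 0")
      case False
      interpret Nz: prob_space "N z" by (rule N(1)[OF False])
      show ?thesis using False N(2)[OF False]
        by (simp add: G_def Nz.distribution_function_eq)
    qed (simp add: G_def)
    then show "0 \<le> V \<omega>" "V \<omega> \<le> 1" by (auto simp: V_def)
  qed
  have cell: "prob {\<omega>\<in>space M. Z \<omega> = z \<and> V \<omega> \<le> v} = v * prob (E z)" if "0 < v" "v < 1" for z v
  proof (cases "prob (E z) = 0")
    case True
    have "prob {\<omega>\<in>space M. Z \<omega> = z \<and> V \<omega> \<le> v} \<le> prob (E z)"
      by (rule finite_measure_mono) (auto simp: E_def)
    then show ?thesis using True by (simp add: order_antisym)
  next
    case False
    let ?A = "{\<omega>\<in>space M. distribution_function (N z) f (f \<omega>) \<le> v}"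
    have "measure (N z) {\<omega>\<in>space (N z). distribution_function (N z) f (f \<omega>) \<le> v} = v"
      by (rule prob_space.probability_integral_transform) (use N[OF False] that in auto)
    then have "measure (N z) ?A = v" by (simp add: N_def)
    moreover have "?A \<in> events"
      using G_meas[of z] False by (simp add: G_def)
    ultimately have "prob (E z \<inter> ?A) / prob (E z) = v" using N(4)[OF False] by simp
    moreover have "E z \<inter> ?A = {\<omega>\<in>space M. Z \<omega> = z \<and> V \<omega> \<le> v}"
      using False by (auto simp: E_def V_def G_def)
    ultimately show ?thesis using False by (simp add: field_simps)
  qed
  have open_case: "prob {\<omega>\<in>space M. Z \<omega> \<in> Q \<and> V \<omega> \<le> v} = v * prob {\<omega>\<in>space M. Z \<omega> \<in> Q}"
    if "0 < v" "v < 1" for Q v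
    using prob_finite_range[OF Z, of "\<lambda>\<omega>. V \<omega> \<le> v" Q] prob_finite_range[OF Z, of "\<lambda>_. True" Q] cell[OF that]
    by (simp add: sum_distrib_left E_def)
  have "prob {\<omega>\<in>space M. Z \<omega> \<in> Q \<and> V \<omega> \<le> v} = v * prob {\<omega>\<in>space M. Z \<omega> \<in> Q}"
    if v: "0 \<le> v" "v \<le> 1" for Q v
  proof -
    \<comment> \<open>The integral transform covers only levels strictly between 0 and 1. Level 0 is
      squeezed by arbitrarily small levels \<open>w\<close>, and level 1 follows from the bound on
      \<open>V\<close>.\<close>
    consider "v = 0" | "v = 1" | "0 < v" "v < 1" using v by linarith
    then show ?thesis
    proof cases
      case 1
      have "prob {\<omega>\<in>space M. Z \<omega> \<in> Q \<and> V \<omega> \<le> 0} \<le> w" if w: "0 < w" "w < 1" for w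
      proof -
        have "prob {\<omega>\<in>space M. Z \<omega> \<in> Q \<and> V \<omega> \<le> 0} \<le> prob {\<omega>\<in>space M. Z \<omega> \<in> Q \<and> V \<omega> \<le> w}"
          using w by (intro finite_measure_mono) auto
        also have "\<dots> \<le> w * 1"
          unfolding open_case[OF w] using w by (intro mult_left_mono) auto
        finally show ?thesis by simp
      qed
      then have "prob {\<omega>\<in>space M. Z \<omega> \<in> Q \<and> V \<omega> \<le> 0} \<le> 0"
        using dense_ge_bounded[OF zero_less_one] by blast
      then show ?thesis using 1 by (simp add: order_antisym)
    next
      case 2
      then show ?thesis using V01(2) by simp
    qed (rule open_case)
  qed
  with V_meas V01 show ?thesis by (rule that)
qed

subsection \<open>The polytope of Bernoulli-compatible matrices\<close>

text \<open>The outer product of the indicator vector of \<open>A\<close> with itself, which is the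
  value of \<open>X X^T\<close> when the 0-1 vector \<open>X\<close> has support
  \<open>A\<close>.\<close>

definition subset_matrix :: "'d set \<Rightarrow> real ^ 'd ^ 'd" where
  "subset_matrix A = (\<chi> i j. of_bool (i \<in> A \<and> j \<in> A))"

section \<open>Bernoulli vectors as random index sets\<close>

lemma measurable_Collect_finite:
  fixes P :: "'d::finite \<Rightarrow> 'a \<Rightarrow> bool"
  assumes [measurable]: "\<And>i. Measurable.pred M (P i)"
  shows "(\<lambda>\<omega>. {i. P i \<omega>}) \<in> M \<rightarrow>\<^sub>M count_space UNIV"
proof (subst measurable_count_space_eq2, simp, intro conjI ballI)
  fix A :: "'d set"
  have "(\<lambda>\<omega>. {i. P i \<omega>}) -` {A} \<inter> space M = {\<omega>\<in>space M. \<forall>i. P i \<omega> \<longleftrightarrow> i \<in> A}" by auto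
  also have "\<dots> \<in> sets M" by measurable
  finally show "(\<lambda>\<omega>. {i. P i \<omega>}) -` {A} \<inter> space M \<in> sets M" .
qed simp

lemma borel_measurable_vec_nth [measurable (raw)]:
  fixes X :: "'a \<Rightarrow> real ^ 'd"
  assumes "X \<in> borel_measurable M"
  shows "(\<lambda>\<omega>. X \<omega> $ i) \<in> borel_measurable M"
  using measurable_compose[OF assms, of "\<lambda>x. x $ i"]
  by (simp add: borel_measurable_continuous_onI continuous_intros)

lemma borel_measurable_vec_lambda:
  fixes X :: "'d::finite \<Rightarrow> 'a \<Rightarrow> real"
  assumes "\<And>i. X i \<in> borel_measurable M"
  shows "(\<lambda>\<omega>. \<chi> i. X i \<omega>) \<in> borel_measurable M"
  using assms by (subst borel_measurable_euclidean_space) (auto simp: Basis_vec_def inner_axis)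

text \<open>A 0-1 vector is determined by its support \<open>S\<close>, and the product of two of
  its coordinates is the indicator of both indices lying in \<open>S\<close>. Since \<open>S\<close>
  takes finitely many values, the expectations become finite sums.\<close>

lemma (in prob_space) bernoulli_compatible_eq_random_subset:
  "bernoulli_compatible M =
    {\<chi> i j. prob {\<omega>\<in>space M. i \<in> S \<omega> \<and> j \<in> S \<omega>} | S :: 'a \<Rightarrow> 'd::finite set. S \<in> M \<rightarrow>\<^sub>M count_space UNIV}"
    (is "_ = ?R")
proof (intro set_eqI iffI)
  fix B :: "real ^ 'd ^ 'd"
  assume "B \<in> bernoulli_compatible M"
  then obtain X :: "'a \<Rightarrow> real ^ 'd" where [measurable]: "X \<in> borel_measurable M"
    and X01: "\<And>\<omega> i. \<omega> \<in> space M \<Longrightarrow> X \<omega> $ i \<in> {0, 1}"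
    and B: "B = (\<chi> i j. expectation (\<lambda>\<omega>. X \<omega> $ i * X \<omega> $ j))"
    by (auto simp: bernoulli_compatible_def bernoulli_vector_def)
  define S where "S \<omega> = {i. X \<omega> $ i = 1}" for \<omega>
  have "S \<in> M \<rightarrow>\<^sub>M count_space UNIV"
    unfolding S_def by (rule measurable_Collect_finite) measurable
  moreover have "expectation (\<lambda>\<omega>. X \<omega> $ i * X \<omega> $ j) = prob {\<omega>\<in>space M. i \<in> S \<omega> \<and> j \<in> S \<omega>}" for i j
  proof -
    have "expectation (\<lambda>\<omega>. X \<omega> $ i * X \<omega> $ j)
        = expectation (indicator {\<omega>\<in>space M. i \<in> S \<omega> \<and> j \<in> S \<omega>})"
    proof (rule Bochner_Integration.integral_cong[OF refl])
      fix \<omega> assume "\<omega> \<in> space M"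
      then show "X \<omega> $ i * X \<omega> $ j = indicator {\<omega>\<in>space M. i \<in> S \<omega> \<and> j \<in> S \<omega>} \<omega>"
        using X01[of \<omega> i] X01[of \<omega> j] by (auto simp: S_def)
    qed
    then show ?thesis by (simp add: Int_absorb2)
  qed
  ultimately show "B \<in> ?R" unfolding B by auto
next
  fix B assume "B \<in> ?R"
  then obtain S :: "'a \<Rightarrow> 'd set" where S [measurable]: "S \<in> M \<rightarrow>\<^sub>M count_space UNIV"
    and B: "B = (\<chi> i j. prob {\<omega>\<in>space M. i \<in> S \<omega> \<and> j \<in> S \<omega>})" by auto
  define X :: "'a \<Rightarrow> real ^ 'd" where "X \<omega> = (\<chi> i. of_bool (i \<in> S \<omega>))" for \<omega>
  have "X \<in> borel_measurable M"
    unfolding X_def by (rule measurable_compose[OF S]) simp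
  then have "bernoulli_vector M X"
    by (simp add: bernoulli_vector_def X_def)
  moreover have "expectation (\<lambda>\<omega>. X \<omega> $ i * X \<omega> $ j) = prob {\<omega>\<in>space M. i \<in> S \<omega> \<and> j \<in> S \<omega>}" for i j
  proof -
    have "expectation (\<lambda>\<omega>. X \<omega> $ i * X \<omega> $ j)
        = expectation (indicator {\<omega>\<in>space M. i \<in> S \<omega> \<and> j \<in> S \<omega>})"
      by (rule Bochner_Integration.integral_cong[OF refl]) (simp add: X_def indicator_def)
    then show ?thesis by (simp add: Int_absorb2)
  qed
  ultimately show "B \<in> bernoulli_compatible M"
    unfolding B bernoulli_compatible_def by auto
qed

lemma (in prob_space) random_subset_matrix_eq_sum:
  fixes S :: "'a \<Rightarrow> 'd::finite set"
  assumes S [measurable]: "S \<in> M \<rightarrow>\<^sub>M count_space UNIV"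
  shows "(\<chi> i j. prob {\<omega>\<in>space M. i \<in> S \<omega> \<and> j \<in> S \<omega>})
    = (\<Sum>A\<in>UNIV. prob {\<omega>\<in>space M. S \<omega> = A} *\<^sub>R subset_matrix A)"
proof -
  have "prob {\<omega>\<in>space M. i \<in> S \<omega> \<and> j \<in> S \<omega>}
      = (\<Sum>A\<in>UNIV. prob {\<omega>\<in>space M. S \<omega> = A} * of_bool (i \<in> A \<and> j \<in> A))" for i j
  proof -
    have "prob {\<omega>\<in>space M. i \<in> S \<omega> \<and> j \<in> S \<omega>} = (\<Sum>A | i \<in> A \<and> j \<in> A. prob {\<omega>\<in>space M. S \<omega> = A})"
      using prob_finite_range[OF S, of "\<lambda>_. True" "{A. i \<in> A \<and> j \<in> A}"] by simp
    also have "\<dots> = (\<Sum>A\<in>UNIV. prob {\<omega>\<in>space M. S \<omega> = A} * of_bool (i \<in> A \<and> j \<in> A))"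
      by (rule sum.mono_neutral_cong_left) auto
    finally show ?thesis .
  qed
  then show ?thesis by (simp add: vec_eq_iff sum_component subset_matrix_def)
qed

lemma (in prob_space) sum_prob_eq_1:
  fixes S :: "'a \<Rightarrow> 'b::finite"
  assumes [measurable]: "S \<in> M \<rightarrow>\<^sub>M count_space UNIV"
  shows "(\<Sum>A\<in>UNIV. prob {\<omega>\<in>space M. S \<omega> = A}) = 1"
  using prob_finite_range[OF assms, of "\<lambda>_. True" UNIV] by (simp add: prob_space)

section \<open>Convexity and the description as a convex hull\<close>

text \<open>A mixture is realised by a coin toss: a uniform \<open>V\<close> independent of both
  random sets selects \<open>S\<close> when \<open>V \<le> s\<close> and \<open>T\<close>
  otherwise.\<close>

lemma (in prob_space) convex_bernoulli_compatible:
  assumes "atomless M"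
  shows "convex (bernoulli_compatible M :: (real ^ 'd ^ 'd) set)"
proof (rule convexI)
  fix B C :: "real ^ 'd ^ 'd" and s t :: real
  assume "B \<in> bernoulli_compatible M" "C \<in> bernoulli_compatible M"
    and st: "0 \<le> s" "0 \<le> t" "s + t = 1"
  then obtain S T :: "'a \<Rightarrow> 'd set"
    where ST [measurable]: "S \<in> M \<rightarrow>\<^sub>M count_space UNIV" "T \<in> M \<rightarrow>\<^sub>M count_space UNIV"
      and B: "B = (\<chi> i j. prob {\<omega>\<in>space M. i \<in> S \<omega> \<and> j \<in> S \<omega>})"
      and C: "C = (\<chi> i j. prob {\<omega>\<in>space M. i \<in> T \<omega> \<and> j \<in> T \<omega>})"
    by (auto simp: bernoulli_compatible_eq_random_subset)
  \<comment> \<open>Pairing the two sets provides a single \<open>V\<close> that is independent of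
    both.\<close>
  define Z where "Z \<omega> = (S \<omega>, T \<omega>)" for \<omega>
  have Z: "Z \<in> M \<rightarrow>\<^sub>M count_space UNIV"
    unfolding Z_def by measurable
  obtain V :: "'a \<Rightarrow> real" where [measurable]: "random_variable borel V"
    and "\<And>\<omega>. 0 \<le> V \<omega>" "\<And>\<omega>. V \<omega> \<le> 1"
    and V: "\<And>Q v. 0 \<le> v \<Longrightarrow> v \<le> 1 \<Longrightarrow>
      prob {\<omega>\<in>space M. Z \<omega> \<in> Q \<and> V \<omega> \<le> v} = v * prob {\<omega>\<in>space M. Z \<omega> \<in> Q}"
    using atomless_imp_independent_uniform[OF assms Z] by blast
  define W where "W \<omega> = (if V \<omega> \<le> s then S \<omega> else T \<omega>)" for \<omega>
  have W: "W \<in> M \<rightarrow>\<^sub>M count_space UNIV" unfolding W_def by measurable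
  have "s * B $ i $ j + t * C $ i $ j = prob {\<omega>\<in>space M. i \<in> W \<omega> \<and> j \<in> W \<omega>}" for i j
  proof -
    \<comment> \<open>The product formula concerns events \<open>V \<le> s\<close> only, so the
      contribution of \<open>T\<close> on \<open>V > s\<close> is obtained as the difference of
      \<open>?T\<close> and \<open>?T'\<close>.\<close>
    let ?S = "{\<omega>\<in>space M. (i \<in> S \<omega> \<and> j \<in> S \<omega>) \<and> V \<omega> \<le> s}"
    let ?T = "{\<omega>\<in>space M. i \<in> T \<omega> \<and> j \<in> T \<omega>}"
    let ?T' = "{\<omega>\<in>space M. (i \<in> T \<omega> \<and> j \<in> T \<omega>) \<and> V \<omega> \<le> s}"
    have "prob ?S = s * B $ i $ j" "prob ?T' = s * C $ i $ j"
      using V[of s "{(P, Q). i \<in> P \<and> j \<in> P}"] V[of s "{(P, Q). i \<in> Q \<and> j \<in> Q}"] st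
      by (simp_all add: Z_def B C)
    moreover have "prob (?T - ?T') = prob ?T - prob ?T'"
      by (rule finite_measure_Diff) auto
    moreover have "prob (?S \<union> (?T - ?T')) = prob ?S + prob (?T - ?T')"
      by (rule finite_measure_Union) auto
    moreover have "{\<omega>\<in>space M. i \<in> W \<omega> \<and> j \<in> W \<omega>} = ?S \<union> (?T - ?T')" by (auto simp: W_def)
    moreover have "t * C $ i $ j = C $ i $ j - s * C $ i $ j"
      using st by (simp add: eq_diff_eq flip: distrib_right)
    moreover have "C $ i $ j = prob ?T" by (simp add: C)
    ultimately show ?thesis by simp
  qed
  then have "s *\<^sub>R B + t *\<^sub>R C = (\<chi> i j. prob {\<omega>\<in>space M. i \<in> W \<omega> \<and> j \<in> W \<omega>})"
    by (simp add: vec_eq_iff)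
  with W show "s *\<^sub>R B + t *\<^sub>R C \<in> bernoulli_compatible M"
    by (auto simp: bernoulli_compatible_eq_random_subset)
qed

text \<open>The law of the random set supplies the weights in one direction. In the other, constant
  sets give the generators and convexity does the rest. A hull of finitely many points is closed,
  which later permits passing to the limit.\<close>

lemma (in prob_space) bernoulli_compatible_eq_convex_hull:
  assumes "atomless M"
  shows "bernoulli_compatible M = convex hull (range (subset_matrix :: 'd::finite set \<Rightarrow> _))"
proof
  show "bernoulli_compatible M \<subseteq> convex hull (range (subset_matrix :: 'd set \<Rightarrow> _))"
  proof
    fix B :: "real ^ 'd ^ 'd" assume "B \<in> bernoulli_compatible M"
    then obtain S :: "'a \<Rightarrow> 'd set" where S: "S \<in> M \<rightarrow>\<^sub>M count_space UNIV"
      and B: "B = (\<Sum>A\<in>UNIV. prob {\<omega>\<in>space M. S \<omega> = A} *\<^sub>R subset_matrix A)"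
      by (auto simp: bernoulli_compatible_eq_random_subset random_subset_matrix_eq_sum)
    show "B \<in> convex hull (range (subset_matrix :: 'd set \<Rightarrow> _))"
      unfolding B by (rule convex_sum) (auto simp: sum_prob_eq_1[OF S] hull_inc)
  qed
next
  show "convex hull (range (subset_matrix :: 'd set \<Rightarrow> _)) \<subseteq> bernoulli_compatible M"
  proof (rule hull_minimal[where S = convex, OF _ convex_bernoulli_compatible[OF assms]], safe)
    fix A :: "'d set"
    have "prob {\<omega>\<in>space M. i \<in> A \<and> j \<in> A} = of_bool (i \<in> A \<and> j \<in> A)" for i j
      by (cases "i \<in> A \<and> j \<in> A") (auto simp: prob_space)
    then show "subset_matrix A \<in> bernoulli_compatible M"
      unfolding bernoulli_compatible_eq_random_subset subset_matrix_def
      by (intro CollectI exI[of _ "\<lambda>_. A"]) simp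
  qed
qed

text \<open>The empty set contributes the zero matrix, so its weight is free. After division by
  \<open>c\<close> the nonempty sets have total weight at most 1, and the empty set absorbs the
  remainder.\<close>

lemma (in prob_space) scaled_random_subset_matrix_in_convex_hull:
  fixes S :: "'a \<Rightarrow> 'd::finite set"
  assumes S [measurable]: "S \<in> M \<rightarrow>\<^sub>M count_space UNIV"
    and c: "0 < c" "prob {\<omega>\<in>space M. S \<omega> \<noteq> {}} \<le> c"
  shows "(1 / c) *\<^sub>R (\<chi> i j. prob {\<omega>\<in>space M. i \<in> S \<omega> \<and> j \<in> S \<omega>}) \<in> convex hull (range subset_matrix)"
proof -
  define w where "w A = (if A = {} then 1 - prob {\<omega>\<in>space M. S \<omega> \<noteq> {}} / c
                         else prob {\<omega>\<in>space M. S \<omega> = A} / c)" for A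
  have "prob {\<omega>\<in>space M. S \<omega> \<noteq> {}} = (\<Sum>A\<in>UNIV - {{}}. prob {\<omega>\<in>space M. S \<omega> = A})"
    using prob_finite_range[OF S, of "\<lambda>_. True" "UNIV - {{}}"] by simp
  then have "sum w UNIV = 1"
    by (simp add: sum.remove[of UNIV "{}"] w_def flip: sum_divide_distrib)
  then have "(\<Sum>A\<in>UNIV. w A *\<^sub>R subset_matrix A) \<in> convex hull (range (subset_matrix :: 'd set \<Rightarrow> _))"
    using c by (intro convex_sum) (auto simp: w_def hull_inc field_simps)
  also have "(\<Sum>A\<in>UNIV. w A *\<^sub>R subset_matrix A)
      = (\<Sum>A\<in>UNIV. (prob {\<omega>\<in>space M. S \<omega> = A} / c) *\<^sub>R (subset_matrix A :: real ^ 'd ^ 'd))"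
  proof (rule sum.cong[OF refl])
    fix A :: "'d set"
    have "subset_matrix {} = (0 :: real ^ 'd ^ 'd)" by (simp add: subset_matrix_def vec_eq_iff)
    then show "w A *\<^sub>R subset_matrix A
        = (prob {\<omega>\<in>space M. S \<omega> = A} / c) *\<^sub>R (subset_matrix A :: real ^ 'd ^ 'd)"
      by (simp add: w_def)
  qed
  also have "\<dots> = (1 / c) *\<^sub>R (\<chi> i j. prob {\<omega>\<in>space M. i \<in> S \<omega> \<and> j \<in> S \<omega>})"
    by (simp add: random_subset_matrix_eq_sum[OF S] scaleR_sum_right)
  finally show ?thesis .
qed

subsection \<open>Tail-dependence matrices\<close>

text \<open>By the integral transform the quotient is identically 1 for \<open>u\<close> between 0
  and 1.\<close>

lemma (in prob_space) tail_dependence_matrix_diagonal: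
  fixes X :: "'a \<Rightarrow> real ^ 'd"
  assumes "tail_dependence_matrix_of M X \<Lambda>"
  shows "\<Lambda> $ i $ i = 1"
proof -
  have [measurable]: "X \<in> borel_measurable M"
    and cont: "continuous_on UNIV (distribution_function M (\<lambda>\<omega>. X \<omega> $ i))"
    and lim: "((\<lambda>u. 1 / u * prob {\<omega>\<in>space M. distribution_function M (\<lambda>\<omega>. X \<omega> $ i) (X \<omega> $ i) \<le> u \<and>
      distribution_function M (\<lambda>\<omega>. X \<omega> $ i) (X \<omega> $ i) \<le> u}) \<longlongrightarrow> \<Lambda> $ i $ i) (at_right 0)"
    using assms unfolding tail_dependence_matrix_of_def has_tail_dependence_coefficient_def by blast+
  have "eventually (\<lambda>u::real. 0 < u \<and> u < 1) (at_right 0)"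
    by (rule eventually_at_rightI[of 0 1]) auto
  then have "eventually (\<lambda>u. 1 / u * prob {\<omega>\<in>space M. distribution_function M (\<lambda>\<omega>. X \<omega> $ i) (X \<omega> $ i) \<le> u \<and>
      distribution_function M (\<lambda>\<omega>. X \<omega> $ i) (X \<omega> $ i) \<le> u} = 1) (at_right 0)"
    by eventually_elim (simp add: probability_integral_transform[OF _ cont])
  from tendsto_unique[OF _ lim tendsto_eventually[OF this]] show ?thesis by simp
qed

text \<open>The factor \<open>1 / CARD('d)\<close> comes from the union bound over the coordinates.
  It puts the rescaled matrix at each level \<open>u\<close> into the polytope, and closedness
  carries this over to the limit.\<close>

lemma (in prob_space) tail_dependence_matrix_imp_bernoulli_compatible:
  fixes X :: "'a \<Rightarrow> real ^ 'd"
  assumes "atomless M" and "tail_dependence_matrix_of M X \<Lambda>"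
  shows "(1 / real CARD('d)) *\<^sub>R \<Lambda> \<in> bernoulli_compatible M"
proof -
  define F where "F i = distribution_function M (\<lambda>\<omega>. X \<omega> $ i)" for i
  have [measurable]: "X \<in> borel_measurable M"
    and cont: "continuous_on UNIV (F i)"
    and lim: "((\<lambda>u. 1 / u * prob {\<omega>\<in>space M. F i (X \<omega> $ i) \<le> u \<and> F j (X \<omega> $ j) \<le> u})
      \<longlongrightarrow> \<Lambda> $ i $ j) (at_right 0)" for i j
    using assms(2) unfolding tail_dependence_matrix_of_def has_tail_dependence_coefficient_def F_def
    by auto
  have [measurable]: "F i \<in> borel_measurable borel" for i
    by (rule borel_measurable_continuous_onI[OF cont])
  define d where "d = real CARD('d)"
  have d: "0 < d" by (simp add: d_def)
  \<comment> \<open>The random set of coordinates that lie in their lower tail at level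
    \<open>u\<close>.\<close>
  define S where "S u \<omega> = {i. F i (X \<omega> $ i) \<le> u}" for u \<omega>
  define B :: "real \<Rightarrow> real ^ 'd ^ 'd"
    where "B u = (1 / (u * d)) *\<^sub>R (\<chi> i j. prob {\<omega>\<in>space M. i \<in> S u \<omega> \<and> j \<in> S u \<omega>})" for u
  have "B u \<in> convex hull (range subset_matrix)" if u: "0 < u" "u < 1" for u
    unfolding B_def
  proof (rule scaled_random_subset_matrix_in_convex_hull)
    show "S u \<in> M \<rightarrow>\<^sub>M count_space UNIV"
      unfolding S_def by (rule measurable_Collect_finite) measurable
    have "{\<omega>\<in>space M. S u \<omega> \<noteq> {}} = (\<Union>i. {\<omega>\<in>space M. F i (X \<omega> $ i) \<le> u})" by (auto simp: S_def)
    also have "prob \<dots> \<le> (\<Sum>i\<in>UNIV. prob {\<omega>\<in>space M. F i (X \<omega> $ i) \<le> u})"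
      by (rule finite_measure_subadditive_finite) auto
    also have "\<dots> = (\<Sum>i\<in>(UNIV :: 'd set). u)"
      using probability_integral_transform[OF _ cont[unfolded F_def] u]
      by (intro sum.cong refl) (simp add: F_def)
    finally show "prob {\<omega>\<in>space M. S u \<omega> \<noteq> {}} \<le> u * d" by (simp add: d_def mult.commute)
  qed (use u d in simp)
  moreover have "eventually (\<lambda>u::real. 0 < u \<and> u < 1) (at_right 0)"
    by (rule eventually_at_rightI[of 0 1]) auto
  ultimately have "eventually (\<lambda>u. B u \<in> convex hull (range subset_matrix)) (at_right 0)"
    by (auto elim: eventually_mono)
  moreover have "(B \<longlongrightarrow> (1 / d) *\<^sub>R \<Lambda>) (at_right 0)"
  proof (intro vec_tendstoI)
    fix i j
    have "((\<lambda>u. 1 / d * (1 / u * prob {\<omega>\<in>space M. F i (X \<omega> $ i) \<le> u \<and> F j (X \<omega> $ j) \<le> u}))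
      \<longlongrightarrow> 1 / d * \<Lambda> $ i $ j) (at_right 0)"
      by (rule tendsto_mult_left[OF lim])
    then show "((\<lambda>u. B u $ i $ j) \<longlongrightarrow> ((1 / d) *\<^sub>R \<Lambda>) $ i $ j) (at_right 0)"
      by (simp add: B_def S_def mult.commute)
  qed
  moreover have "closed (convex hull (range (subset_matrix :: 'd set \<Rightarrow> _)))"
    by (simp add: compact_imp_closed finite_imp_compact_convex_hull)
  ultimately show ?thesis
    unfolding bernoulli_compatible_eq_convex_hull[OF assms(1)] d_def[symmetric]
    by (intro Lim_in_closed_set[of _ B "at_right 0"]) auto
qed

section \<open>Realising a scaled Bernoulli-compatible matrix\<close>

text \<open>For \<open>u < p\<close> the event \<open>Y i \<omega> \<le> u\<close> says that
  \<open>i \<in> S \<omega>\<close> and \<open>V \<omega> \<le> u / p\<close>. The joint probability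
  of two such events is therefore linear in \<open>u\<close>, and the tail quotient already equals
  the entry of \<open>a *\<^sub>R B\<close> before the limit.\<close>

lemma (in prob_space) scaled_bernoulli_compatible_imp_tail_dependence_matrix:
  fixes B :: "real ^ 'd ^ 'd"
  assumes "atomless M" and "B \<in> bernoulli_compatible M" and diag: "\<And>i. (a *\<^sub>R B) $ i $ i = 1"
  shows "a *\<^sub>R B \<in> tail_dependence_matrices M"
proof -
  obtain S :: "'a \<Rightarrow> 'd set" where S [measurable]: "S \<in> M \<rightarrow>\<^sub>M count_space UNIV"
    and B: "B = (\<chi> i j. prob {\<omega>\<in>space M. i \<in> S \<omega> \<and> j \<in> S \<omega>})"
    using assms(2) by (auto simp: bernoulli_compatible_eq_random_subset)
  obtain V :: "'a \<Rightarrow> real" where [measurable]: "random_variable borel V"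
    and V01: "\<And>\<omega>. 0 \<le> V \<omega>" "\<And>\<omega>. V \<omega> \<le> 1"
    and V: "\<And>Q v. 0 \<le> v \<Longrightarrow> v \<le> 1 \<Longrightarrow>
      prob {\<omega>\<in>space M. S \<omega> \<in> Q \<and> V \<omega> \<le> v} = v * prob {\<omega>\<in>space M. S \<omega> \<in> Q}"
    using atomless_imp_independent_uniform[OF assms(1) S] by blast
  define p where "p = 1 / a"
  have diag': "a * prob {\<omega>\<in>space M. i \<in> S \<omega>} = 1" for i using diag[of i] by (simp add: B)
  then have a: "a \<noteq> 0" by auto
  then have p: "prob {\<omega>\<in>space M. i \<in> S \<omega>} = p" for i
    using diag'[of i] by (simp add: p_def field_simps)
  have p01: "0 < p" "p \<le> 1"
    \<comment> \<open>All indices share the same probability \<open>p\<close>, so an arbitrary one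
      yields the bounds; \<open>p\<close> is positive because it is a nonzero probability.\<close>
    using p[of undefined] a measure_nonneg[of M "{\<omega>\<in>space M. undefined \<in> S \<omega>}"]
      prob_le_1[of "{\<omega>\<in>space M. undefined \<in> S \<omega>}"]
    by (auto simp: p_def less_le)
  \<comment> \<open>The uniform \<open>V\<close> is mapped onto the interval from 0 to
    \<open>p\<close> with probability \<open>p\<close> and onto the one from \<open>p\<close> to 1
    with probability \<open>1 - p\<close>, so the mixture is again uniform.\<close>
  define Y where "Y i \<omega> = (if i \<in> S \<omega> then p * V \<omega> else p + (1 - p) * V \<omega>)" for i \<omega>
  have [measurable]: "random_variable borel (Y i)" for i unfolding Y_def by measurable
  have Y_outside: "p \<le> Y i \<omega>" if "i \<notin> S \<omega>" for i \<omega>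
    using that V01[of \<omega>] p01 by (simp add: Y_def)
  have Y01: "0 \<le> Y i \<omega>" "Y i \<omega> \<le> 1" for i \<omega>
  proof -
    show "0 \<le> Y i \<omega>" using V01[of \<omega>] p01 by (simp add: Y_def)
    have "p * V \<omega> \<le> 1 * 1" "(1 - p) * V \<omega> \<le> (1 - p) * 1"
      using V01[of \<omega>] p01 by (intro mult_mono; simp)+
    then show "Y i \<omega> \<le> 1" by (simp add: Y_def)
  qed
  have Y_cdf: "prob {\<omega>\<in>space M. Y i \<omega> \<le> x} = x" if x: "0 \<le> x" "x \<le> 1" for i x
  proof -
    \<comment> \<open>Splitting off \<open>x = 1\<close> guarantees \<open>p < 1\<close> in the last
      case, where \<open>1 - p\<close> is a divisor.\<close>
    consider "x = 1" | "x < p" | "p \<le> x" "x < 1" using x by linarith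
    then show ?thesis
    proof cases
      case 1
      then show ?thesis using Y01(2) by (simp add: prob_space)
    next
      case 2
      have "{\<omega>\<in>space M. Y i \<omega> \<le> x} = {\<omega>\<in>space M. S \<omega> \<in> {A. i \<in> A} \<and> V \<omega> \<le> x / p}"
        using 2 p01 Y_outside by (force simp: Y_def field_simps)
      also have "prob \<dots> = x / p * p"
        using 2 x p01 by (subst V) (auto simp: p)
      finally show ?thesis using p01 by simp
    next
      case 3
      let ?A = "{\<omega>\<in>space M. i \<in> S \<omega>}"
      let ?B = "{\<omega>\<in>space M. S \<omega> \<in> {A. i \<notin> A} \<and> V \<omega> \<le> (x - p) / (1 - p)}"
      \<comment> \<open>At levels \<open>x \<ge> p\<close> the whole event
        \<open>i \<in> S \<omega>\<close> is included, and only the outer branch still depends on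
        \<open>x\<close>.\<close>
      have inside: "p * V \<omega> \<le> x" for \<omega>
        using mult_left_mono[OF V01(2)[of \<omega>], of p] p01 3 by linarith
      have "{\<omega>\<in>space M. Y i \<omega> \<le> x} = ?A \<union> ?B"
        using 3 inside by (auto simp: Y_def field_simps)
      also have "prob \<dots> = prob ?A + prob ?B"
        by (rule finite_measure_Union) auto
      also have "prob ?B = (x - p) / (1 - p) * prob {\<omega>\<in>space M. S \<omega> \<in> {A. i \<notin> A}}"
        using 3 by (intro V) (auto simp: field_simps)
      also have "prob {\<omega>\<in>space M. S \<omega> \<in> {A. i \<notin> A}} = 1 - p"
        using prob_neg[of "\<lambda>\<omega>. i \<in> S \<omega>"] by (simp add: p)
      finally show ?thesis using 3 by (simp add: p)
    qed
  qed
  have F: "distribution_function M (Y i) = (\<lambda>x. max 0 (min 1 x))" for i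
  proof
    fix x :: real
    consider "x < 0" | "0 \<le> x" "x \<le> 1" | "1 < x" by linarith
    then show "distribution_function M (Y i) x = max 0 (min 1 x)"
    proof cases
      case 1
      then have "{\<omega>\<in>space M. Y i \<omega> \<le> x} = {}" using Y01(1)[of i] by (auto simp: not_le intro: less_le_trans)
      then have "prob {\<omega>\<in>space M. Y i \<omega> \<le> x} = 0" by (simp only: measure_empty)
      then show ?thesis using 1 by (simp add: distribution_function_eq)
    next
      case 2
      then show ?thesis by (simp add: distribution_function_eq Y_cdf)
    next
      case 3
      then have "{\<omega>\<in>space M. Y i \<omega> \<le> x} = space M" using Y01(2)[of i] by (auto intro: order_trans less_imp_le)
      then have "prob {\<omega>\<in>space M. Y i \<omega> \<le> x} = 1" by (simp only: prob_space)
      then show ?thesis using 3 by (simp add: distribution_function_eq)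
    qed
  qed
  have tail: "has_tail_dependence_coefficient M (Y i) (Y j) ((a *\<^sub>R B) $ i $ j)" for i j
    unfolding has_tail_dependence_coefficient_def F
  proof (rule tendsto_eventually)
    have "eventually (\<lambda>u. 0 < u \<and> u < p) (at_right 0)"
      using p01 by (intro eventually_at_rightI[of 0 p]) auto
    then show "eventually (\<lambda>u. 1 / u * prob {\<omega>\<in>space M. max 0 (min 1 (Y i \<omega>)) \<le> u \<and> max 0 (min 1 (Y j \<omega>)) \<le> u}
        = (a *\<^sub>R B) $ i $ j) (at_right 0)"
    proof eventually_elim
      fix u assume u: "0 < u \<and> u < p"
      have below: "Y k \<omega> \<le> u \<longleftrightarrow> k \<in> S \<omega> \<and> V \<omega> \<le> u / p" for k \<omega>
        using u p01 Y_outside[of k \<omega>] by (cases "k \<in> S \<omega>") (auto simp: Y_def field_simps)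
      have "{\<omega>\<in>space M. max 0 (min 1 (Y i \<omega>)) \<le> u \<and> max 0 (min 1 (Y j \<omega>)) \<le> u}
          = {\<omega>\<in>space M. S \<omega> \<in> {A. i \<in> A \<and> j \<in> A} \<and> V \<omega> \<le> u / p}"
        using u Y01 by (auto simp: min_absorb2 max_absorb2 below)
      also have "prob \<dots> = u / p * prob {\<omega>\<in>space M. S \<omega> \<in> {A. i \<in> A \<and> j \<in> A}}"
        using u by (intro V) auto
      finally show "1 / u * prob {\<omega>\<in>space M. max 0 (min 1 (Y i \<omega>)) \<le> u \<and> max 0 (min 1 (Y j \<omega>)) \<le> u}
          = (a *\<^sub>R B) $ i $ j"
        using u by (simp add: B p_def)
    qed
  qed
  define X :: "'a \<Rightarrow> real ^ 'd" where "X \<omega> = (\<chi> i. Y i \<omega>)" for \<omega>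
  have "X \<in> borel_measurable M"
    unfolding X_def by (rule borel_measurable_vec_lambda) measurable
  then have "tail_dependence_matrix_of M X (a *\<^sub>R B)"
    using tail by (simp add: tail_dependence_matrix_of_def X_def F continuous_intros)
  then show ?thesis unfolding tail_dependence_matrices_def by blast
qed

theorem theorem3p3:
  fixes M :: "'a measure"
  assumes "prob_space M"
    and "atomless M"
  shows "(\<forall>A :: real ^ 'd ^ 'd. (\<forall>i. A $ i $ i = 1) \<longrightarrow>
           (A \<in> tail_dependence_matrices M \<longleftrightarrow>
            (\<exists>a B. 0 \<le> a \<and> B \<in> bernoulli_compatible M \<and> A = a *\<^sub>R B))) \<and>
         (tail_dependence_matrices M :: (real ^ 'd ^ 'd) set) = scaled_bernoulli_compatible M"
proof -
  interpret prob_space M by fact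
  have eq: "(tail_dependence_matrices M :: (real ^ 'd ^ 'd) set) = scaled_bernoulli_compatible M"
  proof (intro set_eqI iffI)
    fix \<Lambda> :: "real ^ 'd ^ 'd"
    assume "\<Lambda> \<in> tail_dependence_matrices M"
    then obtain X where X: "tail_dependence_matrix_of M X \<Lambda>"
      unfolding tail_dependence_matrices_def by blast
    define B where "B = (1 / real CARD('d)) *\<^sub>R \<Lambda>"
    have "B \<in> bernoulli_compatible M"
      unfolding B_def by (rule tail_dependence_matrix_imp_bernoulli_compatible[OF assms(2) X])
    moreover have "\<Lambda> = real CARD('d) *\<^sub>R B" by (simp add: B_def)
    moreover from this have "(real CARD('d) *\<^sub>R B) $ i $ i = 1" for i
      using tail_dependence_matrix_diagonal[OF X, of i] by metis
    ultimately show "\<Lambda> \<in> scaled_bernoulli_compatible M"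
      unfolding scaled_bernoulli_compatible_def using of_nat_0_le_iff by blast
  next
    fix \<Lambda> :: "real ^ 'd ^ 'd"
    assume "\<Lambda> \<in> scaled_bernoulli_compatible M"
    then show "\<Lambda> \<in> tail_dependence_matrices M"
      unfolding scaled_bernoulli_compatible_def
      using scaled_bernoulli_compatible_imp_tail_dependence_matrix[OF assms(2)] by blast
  qed
  \<comment> \<open>The unit diagonal is built into the scaled set, so for a matrix with unit
    diagonal the equivalence is the set equality unfolded.\<close>
  then show ?thesis
    unfolding eq scaled_bernoulli_compatible_def by blast
qed

end
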